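(* Let $\omega_1,\ldots,\omega_n$ be the fundamental weights of the weight lattice of a simple Lie algebra over the complex numbers (i.e. of an irreducible reduced crystallographic root system of rank $n$). Then for all $1\le i,j,k\le n$ we have $$(\omega_i,\omega_j)(\omega_k,\omega_k)\ge(\omega_i,\omega_k)(\omega_k,\omega_j).$$
   Context: $(\cdot,\cdot)$ is the standard Weyl-group-invariant inner product on the weight lattice. *)

theory Defs
  imports "HOL-Analysis.Analysis"
begin

text \<open>
  Root systems live in a Euclidean space, whose inner product is the Weyl-group-invariant one:
  invariance is lemma \<open>weyl_group_inner\<close>. No normalisation of the inner product is fixed.
  The rank is the dimension of the space, since the roots span it.
\<close>

definition pairing :: "'a::euclidean_space \<Rightarrow> 'a \<Rightarrow> real" where
  "pairing x a = 2 * (x \<bullet> a) / (a \<bullet> a)"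

definition root_reflection :: "'a::euclidean_space \<Rightarrow> 'a \<Rightarrow> 'a" where
  "root_reflection a x = x - pairing x a *\<^sub>R a"

definition root_system :: "'a::euclidean_space set \<Rightarrow> bool" where
  "root_system R \<longleftrightarrow>
     finite R \<and> 0 \<notin> R \<and> span R = UNIV \<and>
     (\<forall>a\<in>R. root_reflection a ` R = R)"

definition crystallographic :: "'a::euclidean_space set \<Rightarrow> bool" where
  "crystallographic R \<longleftrightarrow> (\<forall>a\<in>R. \<forall>b\<in>R. pairing b a \<in> \<int>)"

definition reduced_roots :: "'a::euclidean_space set \<Rightarrow> bool" where
  "reduced_roots R \<longleftrightarrow> (\<forall>a\<in>R. \<forall>c::real. c *\<^sub>R a \<in> R \<longrightarrow> c = 1 \<or> c = -1)"

definition irreducible_roots :: "'a::euclidean_space set \<Rightarrow> bool" where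
  "irreducible_roots R \<longleftrightarrow>
     R \<noteq> {} \<and>
     \<not> (\<exists>S T. S \<noteq> {} \<and> T \<noteq> {} \<and> S \<union> T = R \<and> S \<inter> T = {} \<and>
              (\<forall>s\<in>S. \<forall>t\<in>T. s \<bullet> t = 0))"

inductive_set weyl_group :: "'a::euclidean_space set \<Rightarrow> ('a \<Rightarrow> 'a) set"
  for R :: "'a set" where
  weyl_id: "id \<in> weyl_group R"
| weyl_step: "a \<in> R \<Longrightarrow> w \<in> weyl_group R \<Longrightarrow> root_reflection a \<circ> w \<in> weyl_group R"

lemma root_reflection_inner:
  "root_reflection a x \<bullet> root_reflection a y = x \<bullet> y"
  by (cases "a = 0")
     (simp_all add: root_reflection_def pairing_def inner_diff_left inner_diff_right
        inner_commute field_simps)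

lemma weyl_group_inner:
  "w \<in> weyl_group R \<Longrightarrow> w x \<bullet> w y = x \<bullet> y"
  by (induction rule: weyl_group.induct) (simp_all add: root_reflection_inner)

definition simple_roots :: "'a::euclidean_space set \<Rightarrow> nat \<Rightarrow> (nat \<Rightarrow> 'a) \<Rightarrow> bool" where
  "simple_roots R n \<alpha> \<longleftrightarrow>
     inj_on \<alpha> {1..n} \<and> \<alpha> ` {1..n} \<subseteq> R \<and>
     independent (\<alpha> ` {1..n}) \<and> span (\<alpha> ` {1..n}) = UNIV \<and>
     (\<forall>b\<in>R. \<exists>c :: nat \<Rightarrow> int.
        b = (\<Sum>i=1..n. of_int (c i) *\<^sub>R \<alpha> i) \<and>
        ((\<forall>i\<in>{1..n}. c i \<ge> 0) \<or> (\<forall>i\<in>{1..n}. c i \<le> 0)))"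

text \<open>
  The fundamental weights are the basis dual to the simple coroots \<open>2 \<alpha>\<^sub>j / (\<alpha>\<^sub>j, \<alpha>\<^sub>j)\<close>;
  as the simple roots form a basis, this determines \<open>\<omega> 1, \<dots>, \<omega> n\<close> uniquely.
\<close>

definition fundamental_weights ::
    "nat \<Rightarrow> (nat \<Rightarrow> 'a::euclidean_space) \<Rightarrow> (nat \<Rightarrow> 'a) \<Rightarrow> bool" where
  "fundamental_weights n \<alpha> \<omega> \<longleftrightarrow>
     (\<forall>i\<in>{1..n}. \<forall>j\<in>{1..n}. pairing (\<omega> i) (\<alpha> j) = (if i = j then 1 else 0))"

end

theory Submission
  imports Defs
begin

text \<open>
  Let \<open>u\<^sub>i\<close> be the multiple by \<open>(\<omega>\<^sub>k, \<omega>\<^sub>k)\<close> of the projection of \<open>\<omega>\<^sub>i\<close> to the hyperplane orthogonal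
  to \<open>\<omega>\<^sub>k\<close>. The claim says that \<open>(u\<^sub>i, u\<^sub>j) \<ge> 0\<close>. This hyperplane is spanned by the simple
  roots other than \<open>\<alpha>\<^sub>k\<close>, against which the \<open>u\<^sub>i\<close> with \<open>i \<noteq> k\<close> have nonnegative inner products.
  As distinct simple roots form nonacute angles, their dominant cone lies in the
  cone they generate, so any two dominant vectors have nonnegative inner product.
\<close>

text \<open>Splitting the coefficients by sign gives \<open>x = p - q\<close>. Then
  \<open>q \<bullet> p \<le> 0\<close> and \<open>q \<bullet> x \<ge> 0\<close> force
  \<open>q = 0\<close>, so \<open>x\<close> is a nonnegative combination of vectors whose inner
  products with \<open>y\<close> are nonnegative.\<close>

lemma nonacute_family_inner_nonneg:
  fixes v :: "'i \<Rightarrow> 'a::real_inner"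
  assumes nonacute: "\<And>i j. i \<in> I \<Longrightarrow> j \<in> I \<Longrightarrow> i \<noteq> j \<Longrightarrow> v i \<bullet> v j \<le> 0"
    and x: "x = (\<Sum>i\<in>I. c i *\<^sub>R v i)"
    and x_dom: "\<And>i. i \<in> I \<Longrightarrow> x \<bullet> v i \<ge> 0"
    and y_dom: "\<And>i. i \<in> I \<Longrightarrow> y \<bullet> v i \<ge> 0"
  shows "x \<bullet> y \<ge> 0"
proof -
  define p where "p = (\<Sum>i\<in>I. max 0 (c i) *\<^sub>R v i)"
  define q where "q = (\<Sum>i\<in>I. max 0 (- c i) *\<^sub>R v i)"
  have x_eq: "x = p - q"
    unfolding x p_def q_def sum_subtractf [symmetric]
    by (intro sum.cong) (auto simp: max_def scaleR_diff_left [symmetric])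
  have "q \<bullet> p \<le> 0"
    unfolding p_def q_def inner_sum_left inner_sum_right
  proof (intro sum_nonpos)
    \<comment> \<open>On the diagonal one of the two coefficients vanishes; off it
      \<open>nonacute\<close> applies.\<close>
    fix i j assume "i \<in> I" "j \<in> I"
    then show "max 0 (- c j) *\<^sub>R v j \<bullet> max 0 (c i) *\<^sub>R v i \<le> 0"
      using nonacute [of j i] by (cases "i = j") (auto simp: max_def mult_le_0_iff mult_nonneg_nonpos)
  qed
  moreover have "q \<bullet> x \<ge> 0"
    unfolding q_def inner_sum_left by (intro sum_nonneg) (simp add: x_dom inner_commute)
  ultimately have "q \<bullet> q \<le> 0"
    by (simp add: x_eq inner_diff_right)
  then have "q = 0"
    using inner_gt_zero_iff [of q] by linarith
  then have "x \<bullet> y = (\<Sum>i\<in>I. max 0 (c i) * (y \<bullet> v i))"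
    by (simp add: x_eq p_def inner_sum_right inner_commute [of _ y])
  then show ?thesis
    by (simp add: y_dom sum_nonneg)
qed

lemma span_image_finite_obtain:
  fixes v :: "'i \<Rightarrow> 'a::real_vector"
  assumes "finite I" "inj_on v I" "x \<in> span (v ` I)"
  obtains c where "x = (\<Sum>i\<in>I. c i *\<^sub>R v i)"
proof -
  obtain u where "x = (\<Sum>w\<in>v ` I. u w *\<^sub>R w)"
    using assms by (auto simp: span_finite)
  then have "x = (\<Sum>i\<in>I. u (v i) *\<^sub>R v i)"
    using assms(2) by (simp add: sum.reindex)
  then show ?thesis
    by (rule that)
qed

lemma simple_root_inner_self_pos:
  assumes "root_system R" "simple_roots R n \<alpha>" "i \<in> {1..n}"
  shows "\<alpha> i \<bullet> \<alpha> i > 0"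
  using assms by (force simp: root_system_def simple_roots_def)

lemma fundamental_weight_inner_simple_root:
  assumes "root_system R" "simple_roots R n \<alpha>" "fundamental_weights n \<alpha> \<omega>"
    and "i \<in> {1..n}" "j \<in> {1..n}"
  shows "\<omega> i \<bullet> \<alpha> j = (if i = j then \<alpha> j \<bullet> \<alpha> j / 2 else 0)"
proof -
  have "pairing (\<omega> i) (\<alpha> j) = (if i = j then 1 else 0)"
    using assms by (auto simp: fundamental_weights_def)
  then show ?thesis
    using simple_root_inner_self_pos [OF assms(1,2,5)]
    by (auto simp: pairing_def field_simps split: if_splits)
qed

text \<open>Reads off a coefficient up to a positive factor; its sign and its vanishing are both
  exploited below.\<close>

lemma fundamental_weight_inner_sum:
  assumes "root_system R" "simple_roots R n \<alpha>" "fundamental_weights n \<alpha> \<omega>"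
    and "i \<in> {1..n}"
  shows "\<omega> i \<bullet> (\<Sum>l=1..n. c l *\<^sub>R \<alpha> l) = c i * (\<alpha> i \<bullet> \<alpha> i) / 2"
proof -
  have "\<omega> i \<bullet> (\<Sum>l=1..n. c l *\<^sub>R \<alpha> l) = (\<Sum>l=1..n. if i = l then c l * (\<alpha> l \<bullet> \<alpha> l) / 2 else 0)"
    unfolding inner_sum_right
    by (intro sum.cong)
       (auto simp: fundamental_weight_inner_simple_root [OF assms(1-4)])
  then show ?thesis
    using assms(4) by simp
qed

text \<open>Otherwise reflecting \<open>\<alpha> j\<close> in \<open>\<alpha> i\<close> would give a
  root with a negative coefficient at \<open>\<alpha> i\<close> and a positive one at
  \<open>\<alpha> j\<close>, against the sign condition on roots.\<close>

lemma simple_roots_nonacute: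
  assumes "root_system R" "simple_roots R n \<alpha>" "fundamental_weights n \<alpha> \<omega>"
    and i: "i \<in> {1..n}" and j: "j \<in> {1..n}" and "i \<noteq> j"
  shows "\<alpha> i \<bullet> \<alpha> j \<le> 0"
proof (rule ccontr)
  assume "\<not> ?thesis"
  then have pos: "\<alpha> j \<bullet> \<alpha> i > 0"
    by (simp add: inner_commute)
  define b where "b = root_reflection (\<alpha> i) (\<alpha> j)"
  note root = simple_root_inner_self_pos [OF assms(1,2)]
  note weight = fundamental_weight_inner_simple_root [OF assms(1-3)]
  have "\<alpha> i \<in> R" "\<alpha> j \<in> R"
    using assms(2) i j by (auto simp: simple_roots_def)
  then have "b \<in> R"
    using assms(1) unfolding b_def root_system_def by blast
  then obtain c :: "nat \<Rightarrow> int" where b: "b = (\<Sum>l=1..n. of_int (c l) *\<^sub>R \<alpha> l)"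
    and sign: "(\<forall>l\<in>{1..n}. c l \<ge> 0) \<or> (\<forall>l\<in>{1..n}. c l \<le> 0)"
    using assms(2) unfolding simple_roots_def by blast
  \<comment> \<open>As \<open>\<omega> i\<close> is orthogonal to \<open>\<alpha> j\<close>, only
    the subtracted positive multiple of \<open>\<alpha> i\<close> counts.\<close>
  have "\<omega> i \<bullet> b < 0"
    using pos root [OF i] i j \<open>i \<noteq> j\<close>
    by (simp add: b_def root_reflection_def pairing_def inner_diff_right weight)
  then have "c i < 0"
    unfolding b fundamental_weight_inner_sum [OF assms(1-3) i]
    using root [OF i] by (simp add: mult_less_0_iff)
  moreover have "\<omega> j \<bullet> b > 0"
    using root [OF j] i j \<open>i \<noteq> j\<close>
    by (simp add: b_def root_reflection_def inner_diff_right weight)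
  then have "c j > 0"
    unfolding b fundamental_weight_inner_sum [OF assms(1-3) j]
    using root [OF j] by (simp add: zero_less_mult_iff)
  ultimately show False
    using sign i j by fastforce
qed

theorem proposition1p4:
  fixes R :: "'a::euclidean_space set"
    and \<alpha> \<omega> :: "nat \<Rightarrow> 'a"
    and n i j k :: nat
  assumes "root_system R" "crystallographic R" "reduced_roots R" "irreducible_roots R"
    and "n = DIM('a)"
    and "simple_roots R n \<alpha>"
    and "fundamental_weights n \<alpha> \<omega>"
    and "i \<in> {1..n}" "j \<in> {1..n}" "k \<in> {1..n}"
  shows "(\<omega> i \<bullet> \<omega> j) * (\<omega> k \<bullet> \<omega> k) \<ge> (\<omega> i \<bullet> \<omega> k) * (\<omega> k \<bullet> \<omega> j)"
proof (cases "i = k \<or> j = k")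
  \<comment> \<open>Here both sides coincide.\<close>
  case True
  then show ?thesis
    by (auto simp: mult.commute)
next
  case False
  note root = simple_root_inner_self_pos [OF assms(1,6)]
  note weight = fundamental_weight_inner_simple_root [OF assms(1,6,7)]
  define K where "K = \<omega> k \<bullet> \<omega> k"
  define u where "u l = K *\<^sub>R \<omega> l - (\<omega> l \<bullet> \<omega> k) *\<^sub>R \<omega> k" for l
  have "\<omega> k \<bullet> \<alpha> k \<noteq> 0"
    using weight [OF assms(10,10)] root [OF assms(10)] by force
  then have K: "K > 0"
    by (auto simp: K_def)
  \<comment> \<open>For \<open>m \<noteq> k\<close> the correction along \<open>\<omega> k\<close>
    is orthogonal to \<open>\<alpha> m\<close>.\<close>
  have u_dom: "u l \<bullet> \<alpha> m \<ge> 0" if "l \<in> {1..n}" "m \<in> {1..n} - {k}" for l m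
    using that K root [of m] assms(10) by (simp add: u_def inner_diff_left weight)
  obtain c where c: "u i = (\<Sum>l\<in>{1..n}. c l *\<^sub>R \<alpha> l)"
    using assms(6) span_image_finite_obtain [of "{1..n}" \<alpha> "u i"]
    by (auto simp: simple_roots_def)
  \<comment> \<open>Orthogonality to \<open>\<omega> k\<close> removes \<open>\<alpha> k\<close>
    from the expansion of \<open>u i\<close>, the one simple root against which dominance is not
    established.\<close>
  have "\<omega> k \<bullet> u i = 0"
    by (simp add: u_def K_def inner_diff_right inner_commute)
  then have "c k = 0"
    using root [OF assms(10)]
    unfolding c fundamental_weight_inner_sum [OF assms(1,6,7,10)] by simp
  then have ui: "u i = (\<Sum>l\<in>{1..n} - {k}. c l *\<^sub>R \<alpha> l)"
    using sum.remove [OF _ assms(10), of "\<lambda>l. c l *\<^sub>R \<alpha> l"] by (simp add: c)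
  have "u i \<bullet> u j \<ge> 0"
    by (rule nonacute_family_inner_nonneg [OF _ ui])
       (use simple_roots_nonacute [OF assms(1,6,7)] u_dom assms(8,9) in auto)
  \<comment> \<open>The scaling by \<open>K\<close> leaves one spare factor \<open>K > 0\<close> to
    cancel.\<close>
  moreover have "u i \<bullet> u j = K * ((\<omega> i \<bullet> \<omega> j) * K - (\<omega> i \<bullet> \<omega> k) * (\<omega> k \<bullet> \<omega> j))"
    by (simp add: u_def inner_diff_left inner_diff_right K_def inner_commute algebra_simps)
  ultimately have "(\<omega> i \<bullet> \<omega> j) * K - (\<omega> i \<bullet> \<omega> k) * (\<omega> k \<bullet> \<omega> j) \<ge> 0"
    using K by (simp add: zero_le_mult_iff)
  then show ?thesis
    by (simp add: K_def)
qed

end
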